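(* Assume the Schanuel conjecture. Then: for every $b\in\overline{\mathbb{Q}}\setminus\{0,1\}$ and every nonzero value $\ln b$ of its logarithm, $\ln b\notin EL^{alg}$; in particular $\pi\notin EL^{alg}$ and $e\notin EL^{alg}$; and for every $a\in EL^{alg}\setminus\{0,1\}$, no value of $\ln a$ lies in $EL^{alg}$.
   Context: Schanuel conjecture: if $z_1,\dots,z_n\in\mathbb{C}$ are linearly independent over $\mathbb{Q}$, then at least $n$ of $z_1,\dots,z_n,e^{z_1},\dots,e^{z_n}$ are algebraically independent over $\mathbb{Q}$. For $b\in\mathbb{C}\setminus\{0,1\}$ fix a nonzero value $\ln b$ and define $b^x:=e^{x\ln b}$. For $S\subseteq\mathbb{C}$ let $b^{S}=\{b^x:x\in S\}$ and $\mathrm{Log}_b(S)=\{w: b^w\in S\}$. $\overline{F}$ is the algebraic closure in $\mathbb{C}$ of a field $F$. Define $EL_0:=\mathbb{Q}$, $EL_n:=\overline{EL_{n-1}\big(b^{EL_{n-1}},\mathrm{Log}_b(EL_{n-1})\big)}$, $EL^{(b)}:=\bigcup_{n\ge0}EL_n$; equivalently the smallest algebraically closed subfield $F\subseteq\mathbb{C}$ with $x\in F\iff b^x\in F$. $EL^{alg}:=EL^{(-1)}$ with $\ln(-1)=i\pi$; it equals $EL^{(b)}$ for every algebraic $b\ne0,1$ (any choice of $\ln b$). Its elements are the algebraically based numbers. *)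

theory Defs
  imports "HOL-Analysis.Analysis" "HOL-Computational_Algebra.Polynomial" "HOL-Library.Poly_Mapping"
begin

text \<open>A multivariate polynomial with rational coefficients in variables indexed by nat
  is a finitely supported map from monomials (finitely supported exponent vectors) to Q.\<close>

type_synonym qmpoly = "(nat \<Rightarrow>\<^sub>0 nat) \<Rightarrow>\<^sub>0 rat"

definition mpoly_eval :: "qmpoly \<Rightarrow> (nat \<Rightarrow> complex) \<Rightarrow> complex" where
  "mpoly_eval p x =
     (\<Sum>m\<in>Poly_Mapping.keys p. of_rat (Poly_Mapping.lookup p m) * (\<Prod>i\<in>Poly_Mapping.keys m. x i ^ Poly_Mapping.lookup (m :: nat \<Rightarrow>\<^sub>0 nat) i))"

definition mpoly_vars :: "qmpoly \<Rightarrow> nat set" where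
  "mpoly_vars p = (\<Union>m\<in>Poly_Mapping.keys p. Poly_Mapping.keys m)"

definition alg_indep_Q :: "nat set \<Rightarrow> (nat \<Rightarrow> complex) \<Rightarrow> bool" where
  "alg_indep_Q I x \<longleftrightarrow>
     (\<forall>p. mpoly_vars p \<subseteq> I \<and> mpoly_eval p x = 0 \<longrightarrow> p = 0)"

definition lin_indep_Q :: "nat \<Rightarrow> (nat \<Rightarrow> complex) \<Rightarrow> bool" where
  "lin_indep_Q n z \<longleftrightarrow>
     (\<forall>c :: nat \<Rightarrow> rat. (\<Sum>i<n. of_rat (c i) * z i) = 0 \<longrightarrow> (\<forall>i<n. c i = 0))"

definition schanuel_conjecture :: bool where
  "schanuel_conjecture \<longleftrightarrow>
     (\<forall>n z. lin_indep_Q n z \<longrightarrow>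
        (\<exists>I \<subseteq> {..<2*n}. card I \<ge> n \<and>
           alg_indep_Q I (\<lambda>i. if i < n then z i else exp (z (i - n)))))"

inductive_set gen_field :: "complex set \<Rightarrow> complex set" for S where
  gen_base: "x \<in> S \<Longrightarrow> x \<in> gen_field S"
| gen_zero: "0 \<in> gen_field S"
| gen_one: "1 \<in> gen_field S"
| gen_add: "x \<in> gen_field S \<Longrightarrow> y \<in> gen_field S \<Longrightarrow> x + y \<in> gen_field S"
| gen_uminus: "x \<in> gen_field S \<Longrightarrow> - x \<in> gen_field S"
| gen_mult: "x \<in> gen_field S \<Longrightarrow> y \<in> gen_field S \<Longrightarrow> x * y \<in> gen_field S"
| gen_inverse: "x \<in> gen_field S \<Longrightarrow> inverse x \<in> gen_field S"

definition alg_closure :: "complex set \<Rightarrow> complex set" where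
  "alg_closure F = {z. \<exists>p. p \<noteq> 0 \<and> (\<forall>i. coeff p i \<in> F) \<and> poly p z = 0}"

text \<open>b^x := e^{x ln b} for a fixed choice lnb of ln b.\<close>
definition bpow :: "complex \<Rightarrow> complex \<Rightarrow> complex" where
  "bpow lnb x = exp (x * lnb)"

definition Logb :: "complex \<Rightarrow> complex set \<Rightarrow> complex set" where
  "Logb lnb S = {w. bpow lnb w \<in> S}"

fun EL_level :: "complex \<Rightarrow> nat \<Rightarrow> complex set" where
  "EL_level lnb 0 = \<rat>"
| "EL_level lnb (Suc n) =
     alg_closure (gen_field (EL_level lnb n \<union> bpow lnb ` EL_level lnb n \<union> Logb lnb (EL_level lnb n)))"

definition EL :: "complex \<Rightarrow> complex set" where
  "EL lnb = (\<Union>n. EL_level lnb n)"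

text \<open>EL^alg := EL^(-1) with ln(-1) = i pi.\<close>
definition EL_alg :: "complex set" where
  "EL_alg = EL (\<i> * complex_of_real pi)"

end

theory Submission
  imports Defs
begin

text \<open>
  Put \<open>l = i\<pi>\<close>. Every element of \<open>EL_alg\<close> is algebraic over the field generated by finitely many
  numbers \<open>x\<^sub>1 = 1, x\<^sub>2, \<dots>, x\<^sub>n\<close>, linearly independent over the rationals, and their exponentials
  \<open>exp (l x\<^sub>i)\<close>, such that at each stage one of \<open>x\<^sub>i\<close>, \<open>exp (l x\<^sub>i)\<close> is algebraic over the previous
  stage. As \<open>x\<^sub>1\<close> and \<open>exp (l x\<^sub>1) = -1\<close> are algebraic, this field has transcendence degree less
  than \<open>n\<close>. If \<open>l\<close> were algebraic over it, then all the \<open>l x\<^sub>i\<close> and \<open>exp (l x\<^sub>i)\<close> would be too,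
  contradicting the Schanuel conjecture; hence \<open>l\<close> is not in \<open>EL_alg\<close>. If \<open>exp L\<close> is in \<open>EL_alg\<close>, then
  so is \<open>L / l\<close>, and if \<open>L \<noteq> 0\<close> were also in \<open>EL_alg\<close>, then so would be \<open>l = L / (L / l)\<close>.
\<close>

subsection \<open>Subfields of the complex numbers\<close>

definition complex_subfield :: "complex set \<Rightarrow> bool" where
  "complex_subfield F \<longleftrightarrow> 0 \<in> F \<and> 1 \<in> F \<and> (\<forall>x\<in>F. - x \<in> F \<and> inverse x \<in> F) \<and>
     (\<forall>x\<in>F. \<forall>y\<in>F. x + y \<in> F \<and> x * y \<in> F)"

lemma complex_subfieldI:
  assumes "0 \<in> F" "1 \<in> F" "\<And>x. x \<in> F \<Longrightarrow> - x \<in> F" "\<And>x. x \<in> F \<Longrightarrow> inverse x \<in> F"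
    "\<And>x y. x \<in> F \<Longrightarrow> y \<in> F \<Longrightarrow> x + y \<in> F" "\<And>x y. x \<in> F \<Longrightarrow> y \<in> F \<Longrightarrow> x * y \<in> F"
  shows "complex_subfield F"
  unfolding complex_subfield_def by (intro conjI ballI assms)

context
  fixes F assumes F: "complex_subfield F"
begin

lemma subfield_0: "0 \<in> F" and subfield_1: "1 \<in> F"
  and subfield_uminus: "x \<in> F \<Longrightarrow> - x \<in> F"
  and subfield_inverse: "x \<in> F \<Longrightarrow> inverse x \<in> F"
  and subfield_add: "x \<in> F \<Longrightarrow> y \<in> F \<Longrightarrow> x + y \<in> F"
  and subfield_mult: "x \<in> F \<Longrightarrow> y \<in> F \<Longrightarrow> x * y \<in> F"
  using F unfolding complex_subfield_def by blast+

lemma subfield_diff: "x \<in> F \<Longrightarrow> y \<in> F \<Longrightarrow> x - y \<in> F"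
  using subfield_add[of x "- y"] subfield_uminus by simp

lemma subfield_divide: "x \<in> F \<Longrightarrow> y \<in> F \<Longrightarrow> x / y \<in> F"
  using subfield_mult[of x "inverse y"] subfield_inverse by (simp add: divide_inverse)

lemma subfield_power: "x \<in> F \<Longrightarrow> x ^ n \<in> F"
  by (induction n) (auto intro: subfield_1 subfield_mult)

lemma subfield_sum: "(\<And>i. i \<in> A \<Longrightarrow> f i \<in> F) \<Longrightarrow> sum f A \<in> F"
  by (induction A rule: infinite_finite_induct) (auto intro: subfield_0 subfield_add)

lemma subfield_of_nat: "of_nat n \<in> F"
  by (induction n) (auto intro: subfield_0 subfield_1 subfield_add)

lemma subfield_of_int: "of_int n \<in> F"
  by (cases n rule: int_cases2) (auto intro: subfield_of_nat subfield_uminus)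

lemma subfield_of_rat: "of_rat r \<in> F"
  by (cases r) (auto simp: of_rat_rat intro!: subfield_divide subfield_of_int)

lemma subfield_poly: "(\<And>i. coeff p i \<in> F) \<Longrightarrow> x \<in> F \<Longrightarrow> poly p x \<in> F"
  unfolding poly_altdef by (intro subfield_sum subfield_mult subfield_power)

end

lemma complex_subfield_gen_field: "complex_subfield (gen_field S)"
  by (rule complex_subfieldI) (auto intro: gen_field.intros)

lemma gen_field_least:
  assumes "complex_subfield F" "S \<subseteq> F"
  shows "gen_field S \<subseteq> F"
proof
  fix x assume "x \<in> gen_field S"
  thus "x \<in> F"
    by induction (use assms in \<open>auto intro: subfield_0 subfield_1 subfield_uminus subfield_inverse
      subfield_add subfield_mult\<close>)
qed

lemma gen_field_mono: "S \<subseteq> T \<Longrightarrow> gen_field S \<subseteq> gen_field T"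
  by (rule gen_field_least[OF complex_subfield_gen_field]) (auto intro: gen_base)

lemma alg_closureI: "p \<noteq> 0 \<Longrightarrow> (\<And>i. coeff p i \<in> F) \<Longrightarrow> poly p z = 0 \<Longrightarrow> z \<in> alg_closure F"
  unfolding alg_closure_def by blast

lemma alg_closureE:
  assumes "z \<in> alg_closure F"
  obtains p where "p \<noteq> 0" "\<And>i. coeff p i \<in> F" "poly p z = 0"
  using assms unfolding alg_closure_def by blast

lemma alg_closure_mono: "F \<subseteq> G \<Longrightarrow> alg_closure F \<subseteq> alg_closure G"
  unfolding alg_closure_def by blast

lemma subset_alg_closure:
  assumes "complex_subfield F"
  shows "F \<subseteq> alg_closure F"
proof
  fix x assume "x \<in> F"
  thus "x \<in> alg_closure F"
    by (intro alg_closureI[of "[:-x, 1:]"])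
      (auto simp: coeff_pCons assms subfield_uminus subfield_1 subfield_0 split: nat.split)
qed

subsection \<open>Finite-dimensional spaces over a subfield\<close>

text \<open>The \<open>F\<close>-linear span of \<open>B\<close>. It is inductive because
  \<open>F\<close> is a set of scalars and not a type; its properties follow by adding one term at a
  time.\<close>

inductive_set fspan :: "complex set \<Rightarrow> complex set \<Rightarrow> complex set" for F B where
  fspan_0: "0 \<in> fspan F B"
| fspan_step: "v \<in> fspan F B \<Longrightarrow> c \<in> F \<Longrightarrow> b \<in> B \<Longrightarrow> c * b + v \<in> fspan F B"

lemma fspan_add: "v \<in> fspan F B \<Longrightarrow> w \<in> fspan F B \<Longrightarrow> v + w \<in> fspan F B"
  by (induction rule: fspan.induct) (auto simp: add.assoc intro: fspan.intros)

lemma fspan_sum: "(\<And>i. i \<in> A \<Longrightarrow> f i \<in> fspan F B) \<Longrightarrow> sum f A \<in> fspan F B"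
  by (induction A rule: infinite_finite_induct) (auto intro: fspan_0 fspan_add)

lemma fspan_scale:
  assumes "complex_subfield F" "c \<in> F" "v \<in> fspan F B"
  shows "c * v \<in> fspan F B"
  using assms(3)
proof induction
  case (fspan_step v d b)
  have "(c * d) * b + c * v \<in> fspan F B"
    using fspan_step assms by (auto intro: fspan.fspan_step subfield_mult)
  thus ?case by (simp add: algebra_simps)
qed (simp add: fspan_0)

lemma fspan_base: "complex_subfield F \<Longrightarrow> b \<in> B \<Longrightarrow> b \<in> fspan F B"
  using fspan_step[OF fspan_0, of 1 F b B] by (simp add: subfield_1)

text \<open>Multiplication by \<open>a\<close> is \<open>F\<close>-linear even when \<open>a\<close>
  lies outside \<open>F\<close>, so it suffices to check it on the generators.\<close>

lemma fspan_mult_closed: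
  assumes F: "complex_subfield F" and B: "\<And>b. b \<in> B \<Longrightarrow> a * b \<in> fspan F C"
    and v: "v \<in> fspan F B"
  shows "a * v \<in> fspan F C"
  using v
proof induction
  case (fspan_step v c b)
  have "c * (a * b) + a * v \<in> fspan F C"
    using fspan_step B F by (blast intro: fspan_add fspan_scale)
  thus ?case by (simp add: algebra_simps)
qed (simp add: fspan_0)

lemma fspan_insertE:
  assumes F: "complex_subfield F" and "v \<in> fspan F (insert b B)"
  obtains d s where "d \<in> F" "s \<in> fspan F B" "v = s + d * b"
proof -
  from assms(2) have "\<exists>d s. d \<in> F \<and> s \<in> fspan F B \<and> v = s + d * b"
  proof induction
    case fspan_0
    thus ?case using subfield_0[OF F] fspan.fspan_0 by force
  next
    case (fspan_step v c b')
    then obtain d s where ds: "d \<in> F" "s \<in> fspan F B" "v = s + d * b" by blast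
    show ?case
    proof (cases "b' = b")
      case True
      thus ?thesis using ds fspan_step(2) subfield_add[OF F]
        by (intro exI[of _ "c + d"] exI[of _ s]) (auto simp: algebra_simps)
    next
      case False
      thus ?thesis using ds fspan_step(2,3)
        by (intro exI[of _ d] exI[of _ "c * b' + s"]) (auto intro: fspan.fspan_step)
    qed
  qed
  thus ?thesis using that by blast
qed

text \<open>Gaussian elimination by induction on \<open>B\<close>: a vector \<open>u k\<close> with
  nonzero \<open>b\<close>-component serves as pivot to remove \<open>b\<close> from the others. The
  family is indexed so that repeated values still count as dependent.\<close>

lemma fspan_dependent:
  fixes u :: "'i \<Rightarrow> complex"
  assumes F: "complex_subfield F" and "finite B" "finite J" "card B < card J"
    and "\<And>j. j \<in> J \<Longrightarrow> u j \<in> fspan F B"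
  shows "\<exists>c. (\<forall>j\<in>J. c j \<in> F) \<and> (\<exists>j\<in>J. c j \<noteq> 0) \<and> (\<Sum>j\<in>J. c j * u j) = 0"
  using assms(2-)
proof (induction B arbitrary: J u rule: finite_induct)
  case empty
  have "v = 0" if "v \<in> fspan F {}" for v
    using that by cases auto
  moreover have "J \<noteq> {}" using empty by auto
  ultimately show ?case using empty subfield_1[OF F]
    by (intro exI[of _ "\<lambda>_. 1"]) (auto intro!: sum.neutral)
next
  case (insert b B)
  have "\<forall>j\<in>J. \<exists>d s. d \<in> F \<and> s \<in> fspan F B \<and> u j = s + d * b"
    using insert.prems(3) fspan_insertE[OF F] by metis
  then obtain d s where ds: "\<And>j. j \<in> J \<Longrightarrow> d j \<in> F" "\<And>j. j \<in> J \<Longrightarrow> s j \<in> fspan F B"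
    "\<And>j. j \<in> J \<Longrightarrow> u j = s j + d j * b" by metis
  show ?case
  proof (cases "\<forall>j\<in>J. d j = 0")
    case True
    thus ?thesis using insert.IH[of J u] insert ds by auto
  next
    case False
    then obtain k where k: "k \<in> J" "d k \<noteq> 0" by blast
    define J' where "J' = J - {k}"
    have J': "finite J'" "J = insert k J'" "k \<notin> J'" using k insert.prems by (auto simp: J'_def)
    \<comment> \<open>The multiple of the pivot \<open>u k\<close> that cancels the
      \<open>b\<close>-component of \<open>u j\<close>.\<close>
    define e where "e j = d j / d k" for j
    have e: "e j \<in> F" if "j \<in> J" for j
      using that ds k by (auto simp: e_def intro!: subfield_divide[OF F])
    have "u j + (- e j) * u k \<in> fspan F B" if "j \<in> J'" for j
    proof -
      have "j \<in> J" using that J' by auto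
      have "u j + (- e j) * u k = s j + (- e j) * s k"
        using ds(3)[OF \<open>j \<in> J\<close>] ds(3)[OF k(1)] k(2) by (simp add: e_def field_simps)
      also have "\<dots> \<in> fspan F B"
        using ds(2) \<open>j \<in> J\<close> k e by (intro fspan_add fspan_scale F subfield_uminus) auto
      finally show ?thesis .
    qed
    moreover have "card B < card J'"
      using insert.prems insert.hyps J' by simp
    ultimately obtain c where c: "\<forall>j\<in>J'. c j \<in> F" "\<exists>j\<in>J'. c j \<noteq> 0"
      "(\<Sum>j\<in>J'. c j * (u j + (- e j) * u k)) = 0"
      using insert.IH[of J' "\<lambda>j. u j + (- e j) * u k"] J'(1) by blast
    \<comment> \<open>The pivot receives the total of the multiples that were subtracted.\<close>
    define c' where "c' j = (if j = k then - (\<Sum>j\<in>J'. c j * e j) else c j)" for j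
    have "(\<Sum>j\<in>J'. c' j * u j) = (\<Sum>j\<in>J'. c j * u j)"
      using J' by (intro sum.cong) (auto simp: c'_def)
    hence "(\<Sum>j\<in>J. c' j * u j) = c' k * u k + (\<Sum>j\<in>J'. c j * u j)"
      using J' by simp
    also have "\<dots> = (\<Sum>j\<in>J'. c j * (u j + (- e j) * u k))"
      by (simp add: c'_def right_diff_distrib sum_subtractf sum_distrib_right mult.assoc)
    finally have "(\<Sum>j\<in>J. c' j * u j) = 0" using c by simp
    moreover have "\<forall>j\<in>J. c' j \<in> F"
      using c(1) e J'
      by (auto simp: c'_def intro!: subfield_uminus[OF F] subfield_sum[OF F] subfield_mult[OF F])
    moreover have "\<exists>j\<in>J. c' j \<noteq> 0"
      using c(2) J' by (auto simp: c'_def)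
    ultimately show ?thesis by blast
  qed
qed

text \<open>The \<open>card B + 1\<close> vectors \<open>z ^ j * v\<close> lie in a space with
  \<open>card B\<close> generators, hence are dependent. A dependence is a polynomial in
  \<open>z\<close> times \<open>v\<close>, and \<open>v\<close> can be cancelled.\<close>

lemma alg_closure_if_stable:
  assumes F: "complex_subfield F" and B: "finite B" and v: "v \<in> fspan F B" "v \<noteq> 0"
    and stable: "\<And>w. w \<in> fspan F B \<Longrightarrow> z * w \<in> fspan F B"
  shows "z \<in> alg_closure F"
proof -
  have pw: "z ^ j * v \<in> fspan F B" for j
    by (induction j) (use v stable in \<open>auto simp: mult.assoc\<close>)
  have "\<exists>c. (\<forall>j\<in>{..card B}. c j \<in> F) \<and> (\<exists>j\<in>{..card B}. c j \<noteq> 0) \<and> (\<Sum>j\<in>{..card B}. c j * (z ^ j * v)) = 0"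
    by (rule fspan_dependent[OF F B]) (use pw in auto)
  then obtain c where c: "\<forall>j\<le>card B. c j \<in> F" "\<exists>j\<le>card B. c j \<noteq> 0"
    "(\<Sum>j\<le>card B. c j * (z ^ j * v)) = 0" by auto
  define p where "p = (\<Sum>j\<le>card B. monom (c j) j)"
  have cp: "coeff p i = (if i \<le> card B then c i else 0)" for i
    by (simp add: p_def coeff_sum coeff_monom)
  have "poly p z * v = (\<Sum>j\<le>card B. c j * (z ^ j * v))"
    by (simp add: p_def poly_sum poly_monom sum_distrib_right mult.assoc)
  hence "poly p z = 0" using c v by simp
  moreover have "p \<noteq> 0" using c(2) cp by (metis coeff_0)
  ultimately show ?thesis
    using cp c(1) by (intro alg_closureI) (auto simp: subfield_0[OF F])
qed

text \<open>The products of \<open>z ^ k\<close>, \<open>k < d\<close>, with elements of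
  \<open>B\<close> generate the new space. The \<open>c i\<close> need not lie in \<open>F\<close>;
  they only have to stabilise the old span, which later allows coefficients that are merely
  algebraic over \<open>F\<close>. Multipliers that stabilised the old span still do so, which
  permits adjoining several elements in turn.\<close>

lemma fspan_adjoin_root:
  assumes F: "complex_subfield F" and B: "finite B" "1 \<in> fspan F B" and d: "d > 0"
    and z: "z ^ d = (\<Sum>i<d. c i * z ^ i)"
    and c: "\<And>i v. i < d \<Longrightarrow> v \<in> fspan F B \<Longrightarrow> c i * v \<in> fspan F B"
  obtains C where "finite C" "1 \<in> fspan F C" "\<forall>v\<in>fspan F C. z * v \<in> fspan F C"
    "\<And>a. \<forall>v\<in>fspan F B. a * v \<in> fspan F B \<Longrightarrow> \<forall>v\<in>fspan F C. a * v \<in> fspan F C"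
proof
  define C where "C = (\<lambda>(k, b). z ^ k * b) ` ({..<d} \<times> B)"
  have pw: "z ^ k * v \<in> fspan F C" if "k < d" "v \<in> fspan F B" for k v
    using that by (intro fspan_mult_closed[OF F _ that(2)] fspan_base F) (auto simp: C_def)
  show "finite C" using B by (auto simp: C_def)
  show "1 \<in> fspan F C" using pw[of 0 1] d B by simp
  show "\<forall>v\<in>fspan F C. z * v \<in> fspan F C"
  proof (rule ballI, rule fspan_mult_closed[OF F])
    fix x assume "x \<in> C"
    then obtain k b where kb: "k < d" "b \<in> B" "x = z ^ k * b" by (auto simp: C_def)
    show "z * x \<in> fspan F C"
    proof (cases "Suc k < d")
      case True
      thus ?thesis using pw[of "Suc k" b] kb F by (auto simp: mult.assoc fspan_base)
    next
      \<comment> \<open>The top power \<open>z ^ (d - 1)\<close> leaves the range of exponents, and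
        the equation for \<open>z ^ d\<close> brings it back.\<close>
      case False
      hence "d = Suc k" using kb by simp
      hence "z * x = z ^ d * b" using kb by simp
      also have "\<dots> = (\<Sum>i<d. z ^ i * (c i * b))"
        unfolding z sum_distrib_right by (intro sum.cong) (auto simp: mult_ac)
      also have "\<dots> \<in> fspan F C"
        using kb by (intro fspan_sum pw c fspan_base F) auto
      finally show ?thesis .
    qed
  qed
  show "\<forall>v\<in>fspan F C. a * v \<in> fspan F C" if "\<forall>v\<in>fspan F B. a * v \<in> fspan F B" for a
  proof (rule ballI, rule fspan_mult_closed[OF F])
    fix x assume "x \<in> C"
    then obtain k b where kb: "k < d" "b \<in> B" "x = z ^ k * b" by (auto simp: C_def)
    have "z ^ k * (a * b) \<in> fspan F C" using kb by (intro pw that[rule_format] fspan_base F)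
    thus "a * x \<in> fspan F C" using kb by (simp add: algebra_simps)
  qed
qed

section \<open>Algebraic closures are fields and are algebraically closed\<close>

lemma root_power_degree:
  fixes z :: "'a :: field"
  assumes "p \<noteq> 0" "poly p z = 0"
  shows "degree p > 0" "z ^ degree p = (\<Sum>i<degree p. (- coeff p i / lead_coeff p) * z ^ i)"
proof -
  show "degree p > 0"
    using assms by (cases "degree p = 0") (auto elim!: degree_eq_zeroE)
  have "(\<Sum>i\<le>degree p. coeff p i * z ^ i) = 0" using assms(2) by (simp add: poly_altdef)
  hence "(\<Sum>i<degree p. coeff p i * z ^ i) + lead_coeff p * z ^ degree p = 0"
    by (simp add: lessThan_Suc_atMost[symmetric])
  hence *: "lead_coeff p * z ^ degree p = - (\<Sum>i<degree p. coeff p i * z ^ i)"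
    by (metis add_eq_0_iff)
  have "lead_coeff p \<noteq> 0" using assms by simp
  hence "z ^ degree p = (lead_coeff p * z ^ degree p) / lead_coeff p" by simp
  also have "\<dots> = (\<Sum>i<degree p. (- coeff p i / lead_coeff p) * z ^ i)"
    unfolding * by (simp add: sum_divide_distrib sum_negf)
  finally show "z ^ degree p = (\<Sum>i<degree p. (- coeff p i / lead_coeff p) * z ^ i)" .
qed

text \<open>Starting from the line spanned by 1, the elements of \<open>A\<close> are adjoined one
  by one. The result is a common finite-dimensional space on which all of them act.\<close>

lemma fspan_stable_finite:
  assumes F: "complex_subfield F" and "finite A" "A \<subseteq> alg_closure F"
  obtains B where "finite B" "1 \<in> fspan F B"
    "\<And>a v. a \<in> A \<Longrightarrow> v \<in> fspan F B \<Longrightarrow> a * v \<in> fspan F B"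
proof -
  from assms(2,3) have "\<exists>B. finite B \<and> 1 \<in> fspan F B \<and> (\<forall>a\<in>A. \<forall>v\<in>fspan F B. a * v \<in> fspan F B)"
  proof (induction A rule: finite_induct)
    case empty
    show ?case using fspan_base[OF F, of 1 "{1}"] by (intro exI[of _ "{1}"]) auto
  next
    case (insert z A)
    then obtain B where B: "finite B" "1 \<in> fspan F B" "\<forall>a\<in>A. \<forall>v\<in>fspan F B. a * v \<in> fspan F B"
      by auto
    obtain p where p: "p \<noteq> 0" "\<And>i. coeff p i \<in> F" "poly p z = 0"
      using insert.prems by (auto elim: alg_closureE)
    have coef: "- coeff p i / lead_coeff p \<in> F" for i
      using p by (intro subfield_divide subfield_uminus F)
    obtain C where "finite C" "1 \<in> fspan F C" "\<forall>v\<in>fspan F C. z * v \<in> fspan F C"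
      "\<And>a. \<forall>v\<in>fspan F B. a * v \<in> fspan F B \<Longrightarrow> \<forall>v\<in>fspan F C. a * v \<in> fspan F C"
      by (rule fspan_adjoin_root[OF F B(1,2) root_power_degree[OF p(1,3)] fspan_scale[OF F coef]])
        blast+
    thus ?case using B(3) by (intro exI[of _ C]) blast
  qed
  thus ?thesis using that by blast
qed

text \<open>If \<open>x\<close> and \<open>y\<close> stabilise a common finite-dimensional space, so
  do \<open>x + y\<close>, \<open>x * y\<close> and \<open>- x\<close>; these are then algebraic by
  \<open>alg_closure_if_stable\<close>. The vector 1 is the nonzero vector needed there.\<close>

lemma complex_subfield_alg_closure:
  assumes F: "complex_subfield F"
  shows "complex_subfield (alg_closure F)"
proof -
  have step: "z \<in> alg_closure F"
    if "finite A" "A \<subseteq> alg_closure F"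
      "\<And>B. (\<And>a v. a \<in> A \<Longrightarrow> v \<in> fspan F B \<Longrightarrow> a * v \<in> fspan F B) \<Longrightarrow>
           (\<And>v. v \<in> fspan F B \<Longrightarrow> z * v \<in> fspan F B)" for A z
    using fspan_stable_finite[OF F that(1,2)] that(3)
    by (metis alg_closure_if_stable[OF F] zero_neq_one)
  show ?thesis
  proof (rule complex_subfieldI)
    show "0 \<in> alg_closure F" "1 \<in> alg_closure F"
      using subset_alg_closure[OF F] subfield_0[OF F] subfield_1[OF F] by auto
    show "x + y \<in> alg_closure F" if "x \<in> alg_closure F" "y \<in> alg_closure F" for x y
      using that by (intro step[of "{x, y}"]) (auto simp: distrib_right intro: fspan_add)
    show "x * y \<in> alg_closure F" if "x \<in> alg_closure F" "y \<in> alg_closure F" for x y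
      using that by (intro step[of "{x, y}"]) (auto simp: mult.assoc)
    show "- x \<in> alg_closure F" if "x \<in> alg_closure F" for x
    proof (rule step[of "{x}"])
      fix B v assume *: "\<And>a v. a \<in> {x} \<Longrightarrow> v \<in> fspan F B \<Longrightarrow> a * v \<in> fspan F B" "v \<in> fspan F B"
      have "(-1) * (x * v) \<in> fspan F B"
        using * by (intro fspan_scale[OF F subfield_uminus[OF F subfield_1[OF F]]]) auto
      thus "- x * v \<in> fspan F B" by simp
    qed (use that in auto)
    show "inverse x \<in> alg_closure F" if x: "x \<in> alg_closure F" for x
    proof (cases "x = 0")
      case False
      obtain p where p: "p \<noteq> 0" "\<And>i. coeff p i \<in> F" "poly p x = 0"
        using alg_closureE[OF x] by blast
      \<comment> \<open>Reversing the coefficients turns the nonzero root \<open>x\<close> into the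
        root \<open>inverse x\<close>.\<close>
      show ?thesis
        using p False subfield_0[OF F]
        by (intro alg_closureI[of "reflect_poly p"])
           (auto simp: coeff_reflect_poly poly_reflect_poly_nz)
    qed (use that in auto)
  qed
qed

text \<open>The finitely many normalised coefficients of a polynomial for \<open>z\<close> act on
  one finite-dimensional space over \<open>F\<close>. Adjoining the root \<open>z\<close> keeps it
  finite-dimensional, so \<open>z\<close> is algebraic over \<open>F\<close> itself.\<close>

lemma alg_closure_idem:
  assumes F: "complex_subfield F"
  shows "alg_closure (alg_closure F) = alg_closure F"
proof
  show "alg_closure F \<subseteq> alg_closure (alg_closure F)"
    by (intro subset_alg_closure complex_subfield_alg_closure F)
  show "alg_closure (alg_closure F) \<subseteq> alg_closure F"
  proof
    fix z assume "z \<in> alg_closure (alg_closure F)"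
    then obtain p where p: "p \<noteq> 0" "\<And>i. coeff p i \<in> alg_closure F" "poly p z = 0"
      by (rule alg_closureE) blast
    define c where "c i = - coeff p i / lead_coeff p" for i
    have "c ` {..<degree p} \<subseteq> alg_closure F"
      using p complex_subfield_alg_closure[OF F] unfolding c_def
      by (auto intro!: subfield_divide subfield_uminus)
    then obtain B where B: "finite B" "1 \<in> fspan F B"
      "\<And>a v. a \<in> c ` {..<degree p} \<Longrightarrow> v \<in> fspan F B \<Longrightarrow> a * v \<in> fspan F B"
      using fspan_stable_finite[OF F, of "c ` {..<degree p}"] by auto
    have stable: "- coeff p i / lead_coeff p * v \<in> fspan F B" if "i < degree p" "v \<in> fspan F B" for i v
      using that B(3)[of "c i" v] unfolding c_def by blast
    obtain C where "finite C" "1 \<in> fspan F C" "\<forall>v\<in>fspan F C. z * v \<in> fspan F C"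
      by (rule fspan_adjoin_root[OF F B(1,2) root_power_degree[OF p(1,3)] stable]) blast
    thus "z \<in> alg_closure F"
      by (metis alg_closure_if_stable[OF F] zero_neq_one)
  qed
qed

subsection \<open>The pregeometry of algebraic closure\<close>

text \<open>The closure operator whose rank is transcendence degree; \<open>acl {}\<close> is the
  field of algebraic numbers.\<close>

definition acl :: "complex set \<Rightarrow> complex set" where
  "acl S = alg_closure (gen_field S)"

lemma acl_subfield: "complex_subfield (acl S)"
  unfolding acl_def by (intro complex_subfield_alg_closure complex_subfield_gen_field)

lemma alg_closure_acl: "alg_closure (acl S) = acl S"
  unfolding acl_def by (intro alg_closure_idem complex_subfield_gen_field)

lemma gen_field_subset_acl: "gen_field S \<subseteq> acl S"
  unfolding acl_def by (intro subset_alg_closure complex_subfield_gen_field)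

lemma subset_acl: "S \<subseteq> acl S"
  using gen_field_subset_acl gen_base by blast

lemma acl_least: "S \<subseteq> acl T \<Longrightarrow> acl S \<subseteq> acl T"
  by (metis acl_def acl_subfield alg_closure_acl alg_closure_mono gen_field_least)

lemma acl_mono: "S \<subseteq> T \<Longrightarrow> acl S \<subseteq> acl T"
  using acl_least subset_acl by blast

lemma clear_denominators:
  fixes p :: "complex poly"
  assumes R: "1 \<in> R" "\<And>x y. x \<in> R \<Longrightarrow> y \<in> R \<Longrightarrow> x * y \<in> R"
    and p: "\<And>i. \<exists>a\<in>R. \<exists>b\<in>R. b \<noteq> 0 \<and> coeff p i = a / b"
  shows "\<exists>d\<in>R. d \<noteq> 0 \<and> (\<forall>i\<le>degree p. d * coeff p i \<in> R)"
proof -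
  obtain a b where ab: "\<And>i. a i \<in> R" "\<And>i. b i \<in> R" "\<And>i. b i \<noteq> 0" "\<And>i. coeff p i = a i / b i"
    using p by metis
  have prod: "prod b A \<in> R" for A
    by (induction A rule: infinite_finite_induct) (use R ab in auto)
  define d where "d = (\<Prod>i\<le>degree p. b i)"
  have "d * coeff p i \<in> R" if "i \<le> degree p" for i
  proof -
    have "d = b i * prod b ({..degree p} - {i})"
      unfolding d_def using that by (subst prod.remove[of _ i]) auto
    hence "d * coeff p i = a i * prod b ({..degree p} - {i})"
      using ab(3)[of i] ab(4)[of i] by simp
    thus ?thesis using R(2) ab(1) prod by simp
  qed
  thus ?thesis using prod[of "{..degree p}"] ab(3) by (intro bexI[of _ d]) (auto simp: d_def)
qed

text \<open>The quotients of elements of the ring \<open>R\<close> form a field containing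
  \<open>S\<close>, hence containing \<open>gen_field S\<close>. Clearing denominators then moves
  the coefficients into \<open>R\<close>, where they can be written as polynomial
  expressions.\<close>

lemma acl_subring_poly:
  assumes R: "0 \<in> R" "1 \<in> R" "\<And>x. x \<in> R \<Longrightarrow> - x \<in> R"
    "\<And>x y. x \<in> R \<Longrightarrow> y \<in> R \<Longrightarrow> x + y \<in> R" "\<And>x y. x \<in> R \<Longrightarrow> y \<in> R \<Longrightarrow> x * y \<in> R"
    and S: "S \<subseteq> R" and z: "z \<in> acl S"
  obtains p where "p \<noteq> 0" "\<And>i. coeff p i \<in> R" "poly p z = 0"
proof -
  define Q where "Q = {a / b | a b. a \<in> R \<and> b \<in> R \<and> b \<noteq> 0}"
  have QI: "a / b \<in> Q" if "a \<in> R" "b \<in> R" "b \<noteq> 0" for a b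
    using that by (auto simp: Q_def)
  have RQ: "x \<in> Q" if "x \<in> R" for x
    using QI[OF that R(2)] by simp
  have "complex_subfield Q"
  proof (rule complex_subfieldI)
    show "0 \<in> Q" "1 \<in> Q" using R RQ by auto
  next
    fix x assume "x \<in> Q"
    then obtain a b where x: "x = a / b" "a \<in> R" "b \<in> R" "b \<noteq> 0" by (auto simp: Q_def)
    show "- x \<in> Q" using QI[of "- a" b] x R(3) by simp
    show "inverse x \<in> Q" using QI[of b a] x RQ[OF R(1)] by (cases "a = 0") auto
  next
    fix x y assume "x \<in> Q" "y \<in> Q"
    then obtain a b c d where x: "x = a / b" "a \<in> R" "b \<in> R" "b \<noteq> 0"
      and y: "y = c / d" "c \<in> R" "d \<in> R" "d \<noteq> 0" unfolding Q_def by blast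
    show "x + y \<in> Q" using QI[of "a * d + c * b" "b * d"] x y R by (simp add: add_frac_eq)
    show "x * y \<in> Q" using QI[of "a * c" "b * d"] x y R by simp
  qed
  hence "gen_field S \<subseteq> Q"
    using S RQ by (intro gen_field_least) auto
  moreover obtain p where p: "p \<noteq> 0" "\<And>i. coeff p i \<in> gen_field S" "poly p z = 0"
    using z unfolding acl_def by (rule alg_closureE) blast
  ultimately have "coeff p i \<in> Q" for i by auto
  hence "\<exists>a\<in>R. \<exists>b\<in>R. b \<noteq> 0 \<and> coeff p i = a / b" for i unfolding Q_def by blast
  then obtain d where d: "d \<in> R" "d \<noteq> 0" "\<forall>i\<le>degree p. d * coeff p i \<in> R"
    using clear_denominators[of R p] R by blast
  have "coeff (smult d p) i \<in> R" for i
    using d R(1) by (cases "i \<le> degree p") (auto simp: coeff_eq_0)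
  thus ?thesis using that[of "smult d p"] p d by simp
qed

lemma poly_eq_sum_bound:
  fixes p :: "'a :: comm_semiring_1 poly"
  assumes "degree p \<le> N"
  shows "poly p x = (\<Sum>i\<le>N. coeff p i * x ^ i)"
  unfolding poly_altdef
  by (rule sum.mono_neutral_left) (use assms in \<open>auto simp: coeff_eq_0\<close>)

text \<open>The exchange property: a relation for \<open>y\<close> with coefficients polynomial in
  \<open>t\<close> is a two-variable relation, and reordering it by powers of \<open>t\<close> gives
  a relation for \<open>t\<close> with coefficients polynomial in \<open>y\<close>.\<close>

lemma acl_exchange:
  assumes y: "y \<in> acl (insert t S)" "y \<notin> acl S"
  shows "t \<in> acl (insert y S)"
proof -
  define F where "F = gen_field S"
  have F: "complex_subfield F" by (simp add: F_def complex_subfield_gen_field)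
  note Fs = subfield_0[OF F] subfield_1[OF F] subfield_add[OF F] subfield_mult[OF F]
    subfield_uminus[OF F] subfield_sum[OF F]
  \<comment> \<open>The ring of polynomials in \<open>t\<close> with coefficients in
    \<open>F\<close>.\<close>
  define R where "R = {poly f t | f. \<forall>i. coeff f i \<in> F}"
  have RI: "poly f t \<in> R" if "\<And>i. coeff f i \<in> F" for f
    using that by (auto simp: R_def)
  have c: "[:a:] \<in> {f. \<forall>i. coeff f i \<in> F}" if "a \<in> F" for a
    using that Fs by (auto simp: coeff_pCons split: nat.split)
  have RF: "a \<in> R" if "a \<in> F" for a
    using RI[of "[:a:]"] c[OF that] by simp
  have t: "t \<in> R"
    using RI[of "[:0, 1:]"] Fs by (auto simp: coeff_pCons split: nat.split)
  obtain p where p: "p \<noteq> 0" "\<And>i. coeff p i \<in> R" "poly p y = 0"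
  proof (rule acl_subring_poly[OF _ _ _ _ _ _ y(1), of R])
    show "0 \<in> R" "1 \<in> R" using RF Fs by auto
    show "insert t S \<subseteq> R" using t RF by (auto simp: F_def gen_base)
    show "- x \<in> R" if "x \<in> R" for x
    proof -
      from that obtain f where f: "x = poly f t" "\<forall>i. coeff f i \<in> F" by (auto simp: R_def)
      show ?thesis using RI[of "- f"] f Fs by simp
    qed
    fix x x' assume "x \<in> R" "x' \<in> R"
    then obtain f g where fg: "x = poly f t" "\<forall>i. coeff f i \<in> F" "x' = poly g t" "\<forall>i. coeff g i \<in> F"
      by (auto simp: R_def)
    show "x + x' \<in> R" using RI[of "f + g"] fg Fs by simp
    show "x * x' \<in> R" using RI[of "f * g"] fg by (auto simp: coeff_mult intro!: Fs)
  qed blast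
  have "\<forall>i. \<exists>f. (\<forall>j. coeff f j \<in> F) \<and> coeff p i = poly f t"
    using p(2) unfolding R_def by blast
  then obtain f where f: "\<And>k i. coeff (f k) i \<in> F" "\<And>k. coeff p k = poly (f k) t"
    by metis
  define N where "N = (\<Sum>k\<le>degree p. degree (f k))"
  have N: "degree (f k) \<le> N" if "k \<le> degree p" for k
    unfolding N_def using that by (intro member_le_sum) auto
  \<comment> \<open>The coefficient of the \<open>i\<close>-th power of \<open>t\<close> in the
    two-variable relation, as a polynomial in the variable standing for \<open>y\<close>.\<close>
  define h where "h i = (\<Sum>k\<le>degree p. monom (coeff (f k) i) k)" for i
  have ch: "coeff (h i) k = (if k \<le> degree p then coeff (f k) i else 0)" for i k
    by (simp add: h_def coeff_sum coeff_monom)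
  have hF: "coeff (h i) k \<in> F" for i k by (simp add: ch f(1) Fs(1))
  have hy: "poly (h i) y = (\<Sum>k\<le>degree p. coeff (f k) i * y ^ k)" for i
    by (simp add: h_def poly_sum poly_monom)
  define q where "q = (\<Sum>i\<le>N. monom (poly (h i) y) i)"
  have cq: "coeff q i = (if i \<le> N then poly (h i) y else 0)" for i
    by (simp add: q_def coeff_sum coeff_monom)
  have "poly q t = (\<Sum>i\<le>N. \<Sum>k\<le>degree p. coeff (f k) i * y ^ k * t ^ i)"
    by (simp add: q_def poly_sum poly_monom hy sum_distrib_right)
  also have "\<dots> = (\<Sum>k\<le>degree p. \<Sum>i\<le>N. coeff (f k) i * y ^ k * t ^ i)"
    by (rule sum.swap)
  also have "\<dots> = (\<Sum>k\<le>degree p. coeff p k * y ^ k)"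
  proof (rule sum.cong)
    fix k assume "k \<in> {..degree p}"
    thus "(\<Sum>i\<le>N. coeff (f k) i * y ^ k * t ^ i) = coeff p k * y ^ k"
      using poly_eq_sum_bound[OF N, of k t] by (simp add: f(2) sum_distrib_left mult_ac)
  qed simp
  also have "\<dots> = 0" using p(3) by (simp add: poly_altdef)
  finally have qt: "poly q t = 0" .
  have "f (degree p) \<noteq> 0"
    using p(1) f(2)[of "degree p"] by auto
  then obtain i where i: "coeff (f (degree p)) i \<noteq> 0" by (metis leading_coeff_0_iff)
  have iN: "i \<le> N" using le_degree[OF i] N[of "degree p"] by simp
  have "h i \<noteq> 0" using ch[of i "degree p"] i by auto
  \<comment> \<open>This is where \<open>y\<close> not being algebraic over \<open>F\<close> is
    used: the reordered relation does not vanish identically.\<close>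
  hence "poly (h i) y \<noteq> 0"
    using alg_closureI[of "h i" F y] y(2) hF unfolding acl_def F_def by blast
  hence "q \<noteq> 0" using cq[of i] iN by auto
  moreover have "coeff q i \<in> gen_field (insert y S)" for i
  proof -
    have "F \<subseteq> gen_field (insert y S)" unfolding F_def by (intro gen_field_mono) auto
    hence "poly (h i) y \<in> gen_field (insert y S)"
      using hF by (intro subfield_poly[OF complex_subfield_gen_field]) (auto intro: gen_base)
    thus ?thesis using cq gen_zero by simp
  qed
  ultimately show ?thesis unfolding acl_def using qt by (intro alg_closureI)
qed

text \<open>Steinitz replacement: elements of \<open>A\<close> outside \<open>T\<close> are
  exchanged for elements of \<open>T\<close>, preserving independence and cardinality, until
  \<open>A\<close> lies inside \<open>T\<close>.\<close>

lemma acl_indep_card_le: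
  assumes "finite A" "finite T" "A \<subseteq> acl T" "\<And>a. a \<in> A \<Longrightarrow> a \<notin> acl (A - {a})"
  shows "card A \<le> card T"
  using assms
proof (induction "card (A - T)" arbitrary: A rule: less_induct)
  case less
  show ?case
  proof (cases "A \<subseteq> T")
    case True
    thus ?thesis using less.prems card_mono by blast
  next
    case False
    then obtain a where a: "a \<in> A" "a \<notin> T" by blast
    \<comment> \<open>Otherwise \<open>a\<close>, being in \<open>acl T\<close>, would lie in
      \<open>acl (A - {a})\<close>.\<close>
    have "\<not> T \<subseteq> acl (A - {a})"
      using acl_least[of T "A - {a}"] less.prems(3) less.prems(4)[OF a(1)] a by auto
    then obtain t where t: "t \<in> T" "t \<notin> acl (A - {a})" by blast
    have tA: "t \<notin> A - {a}" using t subset_acl[of "A - {a}"] by auto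
    define A' where "A' = insert t (A - {a})"
    have "A' - T \<subset> A - T" using a t by (auto simp: A'_def)
    hence lt: "card (A' - T) < card (A - T)"
      using less.prems by (intro psubset_card_mono) auto
    have "card A' \<le> card T"
    proof (rule less.hyps[OF lt])
      show "finite A'" using less.prems by (simp add: A'_def)
      show "A' \<subseteq> acl T" using less.prems t subset_acl[of T] by (auto simp: A'_def)
      fix c assume c: "c \<in> A'"
      show "c \<notin> acl (A' - {c})"
      proof (cases "c = t")
        case True
        hence "A' - {c} = A - {a}" using tA by (auto simp: A'_def)
        thus ?thesis using True t by simp
      next
        case False
        hence cA: "c \<in> A" "c \<noteq> a" using c by (auto simp: A'_def)
        have eq: "A' - {c} = insert t (A - {a} - {c})" using False by (auto simp: A'_def)
        have "c \<notin> acl (A - {a} - {c})"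
          using less.prems(4)[OF cA(1)] acl_mono[of "A - {a} - {c}" "A - {c}"] by blast
        moreover have "insert c (A - {a} - {c}) = A - {a}" using cA by auto
        \<comment> \<open>If \<open>c\<close> depended on the rest of \<open>A'\<close>, exchange
          would put \<open>t\<close> into \<open>acl (A - {a})\<close>, against the choice of
          \<open>t\<close>.\<close>
        ultimately show ?thesis using acl_exchange[of c t "A - {a} - {c}"] t eq by auto
      qed
    qed (use less.prems in auto)
    moreover have "card A' = card A"
      using tA card_Suc_Diff1[OF less.prems(1) a(1)] less.prems(1) by (simp add: A'_def)
    ultimately show ?thesis by simp
  qed
qed

subsection \<open>Algebraic independence\<close>

abbreviation mono_eval :: "(nat \<Rightarrow>\<^sub>0 nat) \<Rightarrow> (nat \<Rightarrow> complex) \<Rightarrow> complex" where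
  "mono_eval m x \<equiv> \<Prod>i\<in>Poly_Mapping.keys m. x i ^ Poly_Mapping.lookup m i"

lemma mono_eval_superset:
  assumes "finite A" "Poly_Mapping.keys m \<subseteq> A"
  shows "mono_eval m x = (\<Prod>i\<in>A. x i ^ Poly_Mapping.lookup m i)"
  by (rule prod.mono_neutral_left) (use assms in \<open>auto simp: in_keys_iff\<close>)

lemma mono_eval_add: "mono_eval (m + n) x = mono_eval m x * mono_eval n x"
proof -
  let ?A = "Poly_Mapping.keys m \<union> Poly_Mapping.keys n"
  have "mono_eval (m + n) x = (\<Prod>i\<in>?A. x i ^ Poly_Mapping.lookup (m + n) i)"
    by (rule mono_eval_superset) (use keys_add[of m n] in auto)
  also have "\<dots> = (\<Prod>i\<in>?A. x i ^ Poly_Mapping.lookup m i) * (\<Prod>i\<in>?A. x i ^ Poly_Mapping.lookup n i)"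
    by (simp add: lookup_add power_add prod.distrib)
  also have "\<dots> = mono_eval m x * mono_eval n x"
    by (simp add: mono_eval_superset[of ?A])
  finally show ?thesis .
qed

lemma mpoly_eval_superset:
  assumes "finite A" "Poly_Mapping.keys p \<subseteq> A"
  shows "mpoly_eval p x = (\<Sum>m\<in>A. of_rat (Poly_Mapping.lookup p m) * mono_eval m x)"
  unfolding mpoly_eval_def
  by (rule sum.mono_neutral_left) (use assms in \<open>auto simp: in_keys_iff\<close>)

lemma mpoly_eval_single: "mpoly_eval (Poly_Mapping.single m c) x = of_rat c * mono_eval m x"
  by (simp add: mpoly_eval_superset[of "{m}"])

lemma mpoly_eval_0: "mpoly_eval 0 x = 0"
  by (simp add: mpoly_eval_def)

lemma mpoly_eval_add: "mpoly_eval (p + q) x = mpoly_eval p x + mpoly_eval q x"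
proof -
  let ?A = "Poly_Mapping.keys p \<union> Poly_Mapping.keys q"
  have "mpoly_eval (p + q) x = (\<Sum>m\<in>?A. of_rat (Poly_Mapping.lookup (p + q) m) * mono_eval m x)"
    by (rule mpoly_eval_superset) (use keys_add[of p q] in auto)
  thus ?thesis
    by (simp add: lookup_add of_rat_add distrib_right sum.distrib mpoly_eval_superset[of ?A])
qed

lemma mpoly_eval_sum: "mpoly_eval (sum f A) x = (\<Sum>a\<in>A. mpoly_eval (f a) x)"
  by (induction A rule: infinite_finite_induct) (auto simp: mpoly_eval_0 mpoly_eval_add)

lemma qmpoly_eq_sum_single:
  fixes p :: qmpoly
  shows "p = (\<Sum>m\<in>Poly_Mapping.keys p. Poly_Mapping.single m (Poly_Mapping.lookup p m))"
  by (rule poly_mapping_eqI) (auto simp: lookup_sum lookup_single when_def in_keys_iff)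

lemma mpoly_eval_mult: "mpoly_eval (p * q) x = mpoly_eval p x * mpoly_eval q x"
proof -
  let ?s = "\<lambda>p m. Poly_Mapping.single m (Poly_Mapping.lookup p m) :: qmpoly"
  have "p * q = (\<Sum>m\<in>Poly_Mapping.keys p. \<Sum>n\<in>Poly_Mapping.keys q. ?s p m * ?s q n)"
    by (subst qmpoly_eq_sum_single[of p], subst qmpoly_eq_sum_single[of q]) (rule sum_product)
  hence "mpoly_eval (p * q) x = (\<Sum>m\<in>Poly_Mapping.keys p. \<Sum>n\<in>Poly_Mapping.keys q.
      (of_rat (Poly_Mapping.lookup p m) * mono_eval m x) * (of_rat (Poly_Mapping.lookup q n) * mono_eval n x))"
    by (simp add: mpoly_eval_sum mult_single mpoly_eval_single mono_eval_add of_rat_mult mult_ac)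
  also have "\<dots> = mpoly_eval p x * mpoly_eval q x"
    unfolding mpoly_eval_def by (rule sum_product[symmetric])
  finally show ?thesis .
qed

lemma mpoly_vars_add: "mpoly_vars (p + q) \<subseteq> mpoly_vars p \<union> mpoly_vars q"
  using keys_add[of p q] unfolding mpoly_vars_def by blast

lemma mpoly_vars_mult: "mpoly_vars (p * q) \<subseteq> mpoly_vars p \<union> mpoly_vars q"
proof
  fix i assume "i \<in> mpoly_vars (p * q)"
  then obtain m where m: "m \<in> Poly_Mapping.keys (p * q)" "i \<in> Poly_Mapping.keys m"
    by (auto simp: mpoly_vars_def)
  then obtain a b where ab: "m = a + b" "a \<in> Poly_Mapping.keys p" "b \<in> Poly_Mapping.keys q"
    using keys_mult[of p q] by blast
  thus "i \<in> mpoly_vars p \<union> mpoly_vars q"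
    using m keys_add[of a b] by (auto simp: mpoly_vars_def)
qed

lemma mpoly_vars_sum: "mpoly_vars (sum f A) \<subseteq> (\<Union>a\<in>A. mpoly_vars (f a))"
proof (induction A rule: infinite_finite_induct)
  case (insert a A)
  thus ?case using mpoly_vars_add[of "f a" "sum f A"] by auto
qed (auto simp: mpoly_vars_def)

lemma mpoly_vars_single: "mpoly_vars (Poly_Mapping.single m c) \<subseteq> Poly_Mapping.keys m"
  by (auto simp: mpoly_vars_def)

text \<open>Powers of a variable that does not occur in the coefficients cannot cancel each other:
  the coefficient of \<open>m\<close> in \<open>q k\<close> reappears as that of \<open>m\<close>
  times the \<open>k\<close>-th power of the variable.\<close>

lemma sum_mult_var_power_eq_0D:
  fixes q :: "nat \<Rightarrow> qmpoly"
  assumes zero: "(\<Sum>k\<in>K. q k * Poly_Mapping.single (Poly_Mapping.single i k) 1) = 0"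
    and vars: "\<And>k. k \<in> K \<Longrightarrow> i \<notin> mpoly_vars (q k)" and K: "finite K" "k \<in> K"
  shows "q k = 0"
proof (rule poly_mapping_eqI, rule ccontr)
  fix m assume "Poly_Mapping.lookup (q k) m \<noteq> Poly_Mapping.lookup 0 m"
  hence m: "m \<in> Poly_Mapping.keys (q k)" by (simp add: in_keys_iff)
  let ?e = "\<lambda>k. Poly_Mapping.single i k :: nat \<Rightarrow>\<^sub>0 nat"
  \<comment> \<open>The exponent of the variable \<open>i\<close> determines \<open>l\<close>, so
    distinct pairs give distinct monomials.\<close>
  have eq: "n + ?e l = m + ?e k \<longleftrightarrow> n = m \<and> l = k" if "l \<in> K" "n \<in> Poly_Mapping.keys (q l)" for l n
  proof
    assume *: "n + ?e l = m + ?e k"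
    have "i \<notin> Poly_Mapping.keys n" "i \<notin> Poly_Mapping.keys m"
      using vars that K m by (auto simp: mpoly_vars_def)
    hence "l = k"
      using arg_cong[OF *, of "\<lambda>f. Poly_Mapping.lookup f i"]
      by (simp add: lookup_add in_keys_iff)
    thus "n = m \<and> l = k" using * by simp
  qed auto
  have "q l * Poly_Mapping.single (?e l) 1 =
      (\<Sum>n\<in>Poly_Mapping.keys (q l). Poly_Mapping.single (n + ?e l) (Poly_Mapping.lookup (q l) n))" for l
    by (subst qmpoly_eq_sum_single[of "q l"]) (simp add: sum_distrib_right mult_single)
  hence "0 = Poly_Mapping.lookup (\<Sum>l\<in>K. \<Sum>n\<in>Poly_Mapping.keys (q l).
      Poly_Mapping.single (n + ?e l) (Poly_Mapping.lookup (q l) n)) (m + ?e k)"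
    using zero by simp
  also have "\<dots> = (\<Sum>l\<in>K. \<Sum>n\<in>Poly_Mapping.keys (q l).
      if n = m \<and> l = k then Poly_Mapping.lookup (q l) n else 0)"
    unfolding lookup_sum
    by (intro sum.cong refl) (simp add: lookup_single when_def eq)
  also have "\<dots> = (\<Sum>l\<in>K. if l = k then Poly_Mapping.lookup (q k) m else 0)"
    by (intro sum.cong refl) (use m in \<open>auto simp: if_distrib sum.delta\<close>)
  also have "\<dots> = Poly_Mapping.lookup (q k) m"
    using K by simp
  finally show False using m by (simp add: in_keys_iff)
qed

text \<open>Links the polynomial definition with the closure operator. A relation for
  \<open>x i\<close> has coefficients that are polynomials in the other \<open>x j\<close>; putting
  the variable \<open>i\<close> for the indeterminate gives one polynomial vanishing at
  \<open>x\<close>, whose leading coefficient in that variable would be zero.\<close>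

lemma alg_indep_Q_notin_acl:
  assumes indep: "alg_indep_Q I x" and i: "i \<in> I"
  shows "x i \<notin> acl (x ` (I - {i}))"
proof
  assume "x i \<in> acl (x ` (I - {i}))"
  \<comment> \<open>The ring generated over the rationals by the \<open>x j\<close> with
    \<open>j\<close> in \<open>I - {i}\<close>.\<close>
  define R where "R = {mpoly_eval p x | p. mpoly_vars p \<subseteq> I - {i}}"
  have RI: "mpoly_eval p x \<in> R" if "mpoly_vars p \<subseteq> I - {i}" for p
    using that by (auto simp: R_def)
  have const: "of_rat c \<in> R" for c
    using RI[of "Poly_Mapping.single 0 c"] mpoly_vars_single[of 0 c] by (simp add: mpoly_eval_single)
  have mult: "a * b \<in> R" if "a \<in> R" "b \<in> R" for a b
  proof -
    from that obtain p q where "a = mpoly_eval p x" "b = mpoly_eval q x"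
      "mpoly_vars p \<subseteq> I - {i}" "mpoly_vars q \<subseteq> I - {i}" by (auto simp: R_def)
    thus ?thesis using RI[of "p * q"] mpoly_vars_mult[of p q] by (auto simp: mpoly_eval_mult)
  qed
  obtain p where p: "p \<noteq> 0" "\<And>k. coeff p k \<in> R" "poly p (x i) = 0"
  proof (rule acl_subring_poly[OF _ _ _ _ _ _ \<open>x i \<in> acl (x ` (I - {i}))\<close>, of R])
    show "0 \<in> R" "1 \<in> R" using const[of 0] const[of 1] by auto
    show "- a \<in> R" if "a \<in> R" for a using mult[OF const[of "-1"] that] by simp
    show "a + b \<in> R" if "a \<in> R" "b \<in> R" for a b
    proof -
      from that obtain p q where "a = mpoly_eval p x" "b = mpoly_eval q x"
        "mpoly_vars p \<subseteq> I - {i}" "mpoly_vars q \<subseteq> I - {i}" by (auto simp: R_def)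
      thus ?thesis using RI[of "p + q"] mpoly_vars_add[of p q] by (auto simp: mpoly_eval_add)
    qed
    show "x ` (I - {i}) \<subseteq> R"
    proof
      fix y assume "y \<in> x ` (I - {i})"
      then obtain j where j: "j \<in> I - {i}" "y = x j" by blast
      thus "y \<in> R"
        using RI[of "Poly_Mapping.single (Poly_Mapping.single j 1) 1"]
          mpoly_vars_single[of "Poly_Mapping.single j 1" 1]
        by (auto simp: mpoly_eval_single)
    qed
  qed (use mult in blast)+
  have "\<forall>k. \<exists>q. mpoly_vars q \<subseteq> I - {i} \<and> coeff p k = mpoly_eval q x"
    using p(2) unfolding R_def by blast
  then obtain q where q: "\<And>k. mpoly_vars (q k) \<subseteq> I - {i}" "\<And>k. coeff p k = mpoly_eval (q k) x"
    by metis
  define P where "P = (\<Sum>k\<le>degree p. q k * Poly_Mapping.single (Poly_Mapping.single i k) 1)"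
  have "mpoly_vars P \<subseteq> I"
  proof -
    have "mpoly_vars (q k * Poly_Mapping.single (Poly_Mapping.single i k) 1) \<subseteq> I" for k
      using q(1)[of k] mpoly_vars_mult[of "q k" "Poly_Mapping.single (Poly_Mapping.single i k) 1"]
        mpoly_vars_single[of "Poly_Mapping.single i k" 1] i by (auto split: if_splits)
    thus ?thesis unfolding P_def
      using mpoly_vars_sum[of "\<lambda>k. q k * Poly_Mapping.single (Poly_Mapping.single i k) 1" "{..degree p}"]
      by blast
  qed
  moreover have "mpoly_eval P x = poly p (x i)"
  proof -
    have "mono_eval (Poly_Mapping.single i k) x = x i ^ k" for k
      using mono_eval_superset[of "{i}" "Poly_Mapping.single i k" x] by simp
    thus ?thesis
      by (simp add: P_def mpoly_eval_sum mpoly_eval_mult mpoly_eval_single q(2) poly_altdef)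
  qed
  ultimately have "P = 0" using indep p(3) unfolding alg_indep_Q_def by simp
  have "q (degree p) = 0"
    by (rule sum_mult_var_power_eq_0D[OF \<open>P = 0\<close>[unfolded P_def]]) (use q(1) in auto)
  hence "lead_coeff p = 0" using q(2) by (simp add: mpoly_eval_0)
  thus False using p(1) by simp
qed

text \<open>The bound by transcendence degree, transferred from sets to families; a repeated value
  would lie in the closure of the others, so \<open>x\<close> is injective on
  \<open>I\<close>.\<close>

lemma alg_indep_Q_card_le:
  assumes indep: "alg_indep_Q I x" and I: "finite I" and T: "finite T" "x ` I \<subseteq> acl T"
  shows "card I \<le> card T"
proof -
  have inj: "inj_on x I"
  proof (rule inj_onI, rule ccontr)
    fix i j assume ij: "i \<in> I" "j \<in> I" "x i = x j" "i \<noteq> j"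
    hence "x i \<in> x ` (I - {i})" by auto
    thus False using alg_indep_Q_notin_acl[OF indep ij(1)] subset_acl[of "x ` (I - {i})"] by auto
  qed
  have "card (x ` I) \<le> card T"
  proof (rule acl_indep_card_le)
    fix a assume "a \<in> x ` I"
    then obtain i where i: "i \<in> I" "a = x i" by blast
    have "x ` I - {a} = x ` (I - {i})" using inj i by (auto simp: inj_on_def)
    thus "a \<notin> acl (x ` I - {a})" using alg_indep_Q_notin_acl[OF indep i(1)] i by simp
  qed (use I T in auto)
  thus ?thesis using card_image[OF inj] by simp
qed

subsection \<open>Towers of logarithms and exponentials\<close>

interpretation ratvs: vector_space "\<lambda>(r::rat) (x::complex). of_rat r * x"
  by unfold_locales (auto simp: algebra_simps of_rat_add of_rat_mult)

definition el_hull :: "complex \<Rightarrow> complex set \<Rightarrow> complex set" where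
  "el_hull l X = acl (X \<union> bpow l ` X)"

lemma el_hull_subfield: "complex_subfield (el_hull l X)"
  unfolding el_hull_def by (rule acl_subfield)

lemma el_hull_mono: "X \<subseteq> Y \<Longrightarrow> el_hull l X \<subseteq> el_hull l Y"
  unfolding el_hull_def by (intro acl_mono) auto

lemma el_hull_base: "x \<in> X \<Longrightarrow> x \<in> el_hull l X \<and> bpow l x \<in> el_hull l X"
  using subset_acl[of "X \<union> bpow l ` X"] unfolding el_hull_def by auto

lemma bpow_add: "bpow l (x + y) = bpow l x * bpow l y"
  by (simp add: bpow_def distrib_right exp_add)

lemma bpow_of_nat_mult: "bpow l (of_nat n * x) = bpow l x ^ n"
  by (simp add: bpow_def mult.assoc exp_of_nat_mult)

text \<open>For denominator \<open>q\<close>, the number \<open>bpow l (x / q)\<close> is a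
  \<open>q\<close>-th root of \<open>bpow l x\<close>, hence lies in the algebraically closed
  \<open>K\<close>; the numerator only takes a power, or the inverse of one.\<close>

lemma bpow_of_rat_mult:
  assumes K: "complex_subfield K" "alg_closure K \<subseteq> K" and x: "bpow l x \<in> K"
  shows "bpow l (of_rat r * x) \<in> K"
proof -
  obtain p q where pq: "r = Fract p q" "q > 0" by (cases r) auto
  define y where "y = bpow l (x / of_int q)"
  have "of_nat (nat q) * (x / of_int q) = x" using pq by simp
  hence "y ^ nat q = bpow l x" unfolding y_def by (metis bpow_of_nat_mult)
  moreover have "coeff (monom 1 (nat q) - [:bpow l x:]) i \<in> K" for i
    using x K(1)
    by (auto simp: coeff_pCons split: nat.split intro!: subfield_uminus subfield_diff subfield_0 subfield_1)
  moreover have "monom 1 (nat q) - [:bpow l x:] \<noteq> 0"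
  proof
    assume "monom 1 (nat q) - [:bpow l x:] = 0"
    hence "coeff (monom 1 (nat q) - [:bpow l x:]) (nat q) = 0" by simp
    thus False using pq by (auto simp: coeff_pCons split: nat.splits)
  qed
  ultimately have "y \<in> alg_closure K"
    by (intro alg_closureI[of "monom 1 (nat q) - [:bpow l x:]"]) (auto simp: poly_monom)
  hence y: "y \<in> K" using K by blast
  have rx: "of_rat r * x = of_int p * (x / of_int q)" using pq by (simp add: of_rat_rat)
  show ?thesis
  proof (cases "p \<ge> 0")
    case True
    hence "bpow l (of_rat r * x) = y ^ nat p"
      unfolding rx y_def bpow_of_nat_mult[symmetric] by simp
    thus ?thesis using y K by (simp add: subfield_power)
  next
    case False
    hence "of_int p * (x / of_int q) = - (of_nat (nat (- p)) * (x / of_int q))" by simp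
    hence "bpow l (of_rat r * x) = inverse (bpow l (of_nat (nat (- p)) * (x / of_int q)))"
      unfolding rx by (simp only: bpow_def mult_minus_left exp_minus)
    hence "bpow l (of_rat r * x) = inverse (y ^ nat (- p))"
      unfolding bpow_of_nat_mult y_def .
    thus ?thesis using y K by (simp add: subfield_power subfield_inverse)
  qed
qed

text \<open>The \<open>w\<close> for which both \<open>w\<close> and \<open>bpow l w\<close> lie in
  the hull form a rational subspace containing \<open>X\<close>.\<close>

lemma el_hull_span:
  assumes "w \<in> ratvs.span X"
  shows "w \<in> el_hull l X \<and> bpow l w \<in> el_hull l X"
proof -
  let ?K = "el_hull l X"
  note K = el_hull_subfield[of l X]
  have alg: "alg_closure ?K \<subseteq> ?K" by (simp add: el_hull_def alg_closure_acl)
  have "ratvs.span X \<subseteq> {w. w \<in> ?K \<and> bpow l w \<in> ?K}"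
  proof (rule ratvs.span_minimal)
    show "ratvs.subspace {w. w \<in> ?K \<and> bpow l w \<in> ?K}"
      by (rule ratvs.subspaceI)
         (auto simp: bpow_add subfield_0[OF K] subfield_add[OF K] subfield_mult[OF K]
           subfield_of_rat[OF K] bpow_of_rat_mult[OF K alg] bpow_def[of _ 0] subfield_1[OF K])
  qed (use el_hull_base in auto)
  thus ?thesis using assms by blast
qed

text \<open>The set \<open>T\<close> witnesses that the transcendence degree of the hull is below \<open>card X\<close>.\<close>

definition el_tower :: "complex \<Rightarrow> complex set \<Rightarrow> bool" where
  "el_tower l X \<longleftrightarrow> finite X \<and> ratvs.independent X \<and>
     (\<exists>T. finite T \<and> card T < card X \<and> X \<union> bpow l ` X \<subseteq> acl T)"

text \<open>For \<open>w\<close> in the span of \<open>X\<close> nothing is added. Otherwise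
  \<open>X\<close> grows by \<open>w\<close>, while \<open>T\<close> grows by at most one element,
  since one of \<open>w\<close>, \<open>bpow l w\<close> is already algebraic over \<open>T\<close>;
  the strict inequality of cardinalities survives.\<close>

lemma el_tower_extend:
  assumes X: "el_tower l X" and w: "w \<in> el_hull l X \<or> bpow l w \<in> el_hull l X"
  obtains Y where "el_tower l Y" "X \<subseteq> Y" "w \<in> el_hull l Y" "bpow l w \<in> el_hull l Y"
proof (cases "w \<in> ratvs.span X")
  case True
  thus ?thesis using that[of X] X el_hull_span by blast
next
  case False
  obtain T where T: "finite T" "card T < card X" "X \<union> bpow l ` X \<subseteq> acl T"
    and X': "finite X" "ratvs.independent X" using X unfolding el_tower_def by blast
  have hull: "el_hull l X \<subseteq> acl T" unfolding el_hull_def by (rule acl_least[OF T(3)])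
  \<comment> \<open>The member of the pair that is not known to lie in the hull of
    \<open>X\<close>.\<close>
  define t where "t = (if w \<in> el_hull l X then bpow l w else w)"
  have "acl T \<subseteq> acl (insert t T)" by (intro acl_mono) auto
  moreover have "{w, bpow l w} \<subseteq> insert t (acl T)" using w hull by (auto simp: t_def)
  ultimately have sub: "insert w X \<union> bpow l ` insert w X \<subseteq> acl (insert t T)"
    using T(3) subset_acl[of "insert t T"] by auto
  have "w \<notin> X" using False ratvs.span_base by auto
  hence "card (insert t T) < card (insert w X)"
    using T X' card_insert_le_m1[of "card T + 1" T t] by (simp add: card_insert_if)
  moreover have "ratvs.independent (insert w X)"
    using X' False by (simp add: ratvs.independent_insertI)
  ultimately have "el_tower l (insert w X)"
    unfolding el_tower_def using X' T(1) sub by (intro conjI exI[of _ "insert t T"]) auto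
  thus ?thesis using that[of "insert w X"] el_hull_base[of w "insert w X" l] by auto
qed

text \<open>Every tower, not just some tower, must extend to reach \<open>x\<close>. Thus several
  elements can be reached in succession by extending one tower.\<close>

definition el_reachable :: "complex \<Rightarrow> complex set \<Rightarrow> bool" where
  "el_reachable l S \<longleftrightarrow>
     (\<forall>x\<in>S. \<forall>X. el_tower l X \<longrightarrow> (\<exists>Y. el_tower l Y \<and> X \<subseteq> Y \<and> x \<in> el_hull l Y))"

lemma el_reachableE:
  assumes "el_reachable l S" "x \<in> S" "el_tower l X"
  obtains Y where "el_tower l Y" "X \<subseteq> Y" "x \<in> el_hull l Y"
  using assms unfolding el_reachable_def by blast

lemma el_reachable_finite:
  assumes S: "el_reachable l S" and "finite A" "A \<subseteq> S" "el_tower l X"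
  shows "\<exists>Y. el_tower l Y \<and> X \<subseteq> Y \<and> A \<subseteq> el_hull l Y"
  using assms(2-)
proof (induction A rule: finite_induct)
  case (insert a A)
  then obtain Y where Y: "el_tower l Y" "X \<subseteq> Y" "A \<subseteq> el_hull l Y" by auto
  obtain Z where "el_tower l Z" "Y \<subseteq> Z" "a \<in> el_hull l Z"
    using el_reachableE[OF S _ Y(1), of a] insert.prems by blast
  thus ?case using Y el_hull_mono[of Y Z l] by (intro exI[of _ Z]) auto
qed auto

text \<open>Each element of the generated field already lies in the field generated by finitely many
  elements of \<open>S\<close>, and one tower reaches all of these.\<close>

lemma el_reachable_gen_field:
  assumes S: "el_reachable l S"
  shows "el_reachable l (gen_field S)"
proof -
  have "\<exists>A\<subseteq>S. finite A \<and> x \<in> gen_field A" if "x \<in> gen_field S" for x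
    using that
  proof induction
    case (gen_base x)
    thus ?case by (intro exI[of _ "{x}"]) (auto intro: gen_field.gen_base)
  next
    case (gen_add x y)
    then obtain A B where "A \<subseteq> S" "finite A" "x \<in> gen_field A" "B \<subseteq> S" "finite B" "y \<in> gen_field B"
      by blast
    thus ?case using gen_field_mono[of A "A \<union> B"] gen_field_mono[of B "A \<union> B"]
      by (intro exI[of _ "A \<union> B"]) (auto intro: gen_field.gen_add)
  next
    case (gen_mult x y)
    then obtain A B where "A \<subseteq> S" "finite A" "x \<in> gen_field A" "B \<subseteq> S" "finite B" "y \<in> gen_field B"
      by blast
    thus ?case using gen_field_mono[of A "A \<union> B"] gen_field_mono[of B "A \<union> B"]
      by (intro exI[of _ "A \<union> B"]) (auto intro: gen_field.gen_mult)
  qed (auto intro: gen_field.intros)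
  thus ?thesis
    using el_reachable_finite[OF S] gen_field_least[OF el_hull_subfield]
    unfolding el_reachable_def by (meson subsetD)
qed

text \<open>A polynomial has finitely many coefficients, so one tower reaches them all, and its hull
  is algebraically closed.\<close>

lemma el_reachable_alg_closure:
  assumes S: "el_reachable l S"
  shows "el_reachable l (alg_closure S)"
  unfolding el_reachable_def
proof (intro ballI allI impI)
  fix z X assume z: "z \<in> alg_closure S" and X: "el_tower l X"
  obtain p where p: "p \<noteq> 0" "\<And>i. coeff p i \<in> S" "poly p z = 0"
    using z by (rule alg_closureE) blast
  have "range (coeff p) \<subseteq> insert 0 (coeff p ` {..degree p})"
    using coeff_eq_0[of p] by (force simp: image_iff not_less[symmetric])
  hence "finite (range (coeff p))" by (rule finite_subset) auto
  then obtain Y where Y: "el_tower l Y" "X \<subseteq> Y" "range (coeff p) \<subseteq> el_hull l Y"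
    using el_reachable_finite[OF S _ _ X] p(2) by blast
  have "z \<in> alg_closure (el_hull l Y)" using p Y(3) by (intro alg_closureI[of p]) auto
  hence "z \<in> el_hull l Y" by (simp add: el_hull_def alg_closure_acl)
  thus "\<exists>Y. el_tower l Y \<and> X \<subseteq> Y \<and> z \<in> el_hull l Y" using Y by blast
qed

lemma el_reachable_bpow_Logb:
  assumes S: "el_reachable l S"
  shows "el_reachable l (S \<union> bpow l ` S \<union> Logb l S)"
  unfolding el_reachable_def
proof (intro ballI allI impI)
  fix x X assume x: "x \<in> S \<union> bpow l ` S \<union> Logb l S" and X: "el_tower l X"
  \<comment> \<open>A single pair \<open>w\<close>, \<open>bpow l w\<close> covers elements of
    \<open>S\<close>, exponentials and logarithms alike: one member is in \<open>S\<close>, and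
    \<open>x\<close> is one of the two.\<close>
  then obtain w where w: "w \<in> S \<or> bpow l w \<in> S" "x = w \<or> x = bpow l w"
    by (auto simp: Logb_def)
  obtain Y where Y: "el_tower l Y" "X \<subseteq> Y" "w \<in> el_hull l Y \<or> bpow l w \<in> el_hull l Y"
    using w(1) el_reachableE[OF S _ X] by metis
  obtain Z where "el_tower l Z" "Y \<subseteq> Z" "w \<in> el_hull l Z" "bpow l w \<in> el_hull l Z"
    using el_tower_extend[OF Y(1,3)] by blast
  thus "\<exists>Y. el_tower l Y \<and> X \<subseteq> Y \<and> x \<in> el_hull l Y" using w(2) Y(2) by blast
qed

lemma el_reachable_EL_level: "el_reachable l (EL_level l n)"
proof (induction n)
  case 0
  show ?case
    unfolding el_reachable_def by (auto simp: subfield_of_rat[OF el_hull_subfield] elim!: Rats_cases)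
next
  case (Suc n)
  thus ?case
    by (auto intro: el_reachable_alg_closure el_reachable_gen_field el_reachable_bpow_Logb)
qed

text \<open>If \<open>l\<close> were in the hull, the \<open>n\<close> independent numbers
  \<open>l * x\<close>, \<open>x\<close> in \<open>X\<close>, and their exponentials would all be
  algebraic over \<open>T\<close>, which has fewer than \<open>n\<close> elements.\<close>

lemma schanuel_notin_el_hull:
  assumes schanuel: "schanuel_conjecture" and l: "l \<noteq> 0" and X: "el_tower l X"
  shows "l \<notin> el_hull l X"
proof
  assume lX: "l \<in> el_hull l X"
  obtain T where T: "finite T" "card T < card X" "X \<union> bpow l ` X \<subseteq> acl T"
    and X': "finite X" "ratvs.independent X" using X unfolding el_tower_def by blast
  have lT: "l \<in> acl T" using lX acl_least[OF T(3)] unfolding el_hull_def by blast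
  define n where "n = card X"
  obtain f where f: "bij_betw f {..<n} X"
    using ex_bij_betw_nat_finite[OF X'(1)] by (auto simp: n_def atLeast0LessThan)
  \<comment> \<open>With this choice \<open>exp (z i)\<close> equals \<open>bpow l (f i)\<close>,
    and independence passes from \<open>X\<close> to \<open>z\<close> because \<open>l\<close> is
    nonzero.\<close>
  define z where "z i = f i * l" for i
  have "lin_indep_Q n z"
    unfolding lin_indep_Q_def
  proof (intro allI impI)
    fix c :: "nat \<Rightarrow> rat" and i
    assume 0: "(\<Sum>i<n. of_rat (c i) * z i) = 0" and i: "i < n"
    \<comment> \<open>The inverse of the enumeration \<open>f\<close>, turning coefficients indexed
      by numbers into coefficients indexed by elements of \<open>X\<close>.\<close>
    define g where "g = the_inv_into {..<n} f"
    have g: "g (f i) = i" if "i < n" for i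
      using f that by (simp add: g_def bij_betw_def the_inv_into_f_f)
    have "(\<Sum>i<n. of_rat (c i) * f i) * l = 0"
      using 0 by (simp add: z_def sum_distrib_right mult.assoc)
    hence "(\<Sum>i<n. of_rat (c (g (f i))) * f i) = 0" using l g by simp
    hence "(\<Sum>x\<in>X. of_rat (c (g x)) * x) = 0"
      using sum.reindex_bij_betw[OF f, of "\<lambda>x. of_rat (c (g x)) * x"] by simp
    hence "c (g (f i)) = 0"
      using ratvs.independentD[OF X'(2,1) order_refl, of "c \<circ> g" "f i"] bij_betwE[OF f] i by auto
    thus "c i = 0" using g i by simp
  qed
  then obtain I where I: "I \<subseteq> {..<2*n}" "card I \<ge> n"
    "alg_indep_Q I (\<lambda>i. if i < n then z i else exp (z (i - n)))"
    using schanuel unfolding schanuel_conjecture_def by blast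
  have "f i \<in> acl T" "exp (z i) \<in> acl T" if "i < n" for i
  proof -
    have "f i \<in> X" using bij_betwE[OF f] that by auto
    thus "f i \<in> acl T" "exp (z i) \<in> acl T" using T(3) by (auto simp: z_def bpow_def)
  qed
  hence "(\<lambda>i. if i < n then z i else exp (z (i - n))) ` I \<subseteq> acl T"
    using I(1) lT by (auto simp: z_def intro!: subfield_mult[OF acl_subfield])
  hence "card I \<le> card T"
    using I(1) T(1) by (intro alg_indep_Q_card_le[OF I(3)]) (auto intro: finite_subset)
  thus False using I(2) T(2) by (simp add: n_def)
qed

lemma schanuel_notin_EL:
  assumes "schanuel_conjecture" and l: "l \<noteq> 0" "exp l \<in> acl {}"
  shows "l \<notin> EL l"
proof
  assume "l \<in> EL l"
  then obtain n where n: "l \<in> EL_level l n" by (auto simp: EL_def)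
  \<comment> \<open>The starting tower takes \<open>T\<close> empty: both 1 and
    \<open>bpow l 1 = exp l\<close> are algebraic numbers. This provides the initial gap between the
    cardinalities.\<close>
  have "el_tower l {1}"
    unfolding el_tower_def using l(2) subfield_1[OF acl_subfield]
    by (auto intro!: exI[of _ "{}"] simp: bpow_def)
  then obtain Y where "el_tower l Y" "l \<in> el_hull l Y"
    using el_reachableE[OF el_reachable_EL_level n] by blast
  thus False using schanuel_notin_el_hull assms by blast
qed

section \<open>Closure properties of \<open>EL\<close>\<close>

lemma EL_level_mono: "m \<le> n \<Longrightarrow> EL_level l m \<subseteq> EL_level l n"
proof (rule lift_Suc_mono_le[of "EL_level l"])
  fix n
  let ?S = "EL_level l n \<union> bpow l ` EL_level l n \<union> Logb l (EL_level l n)"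
  have "EL_level l n \<subseteq> gen_field ?S" by (auto intro: gen_base)
  also have "\<dots> \<subseteq> EL_level l (Suc n)"
    by (simp add: subset_alg_closure complex_subfield_gen_field)
  finally show "EL_level l n \<subseteq> EL_level l (Suc n)" .
qed auto

lemma EL_divide:
  assumes "x \<in> EL l" "y \<in> EL l"
  shows "x / y \<in> EL l"
proof -
  obtain m n where mn: "x \<in> EL_level l m" "y \<in> EL_level l n" using assms by (auto simp: EL_def)
  \<comment> \<open>A common level of successor form, which is an algebraic closure and hence a
    field.\<close>
  let ?k = "Suc (max m n)"
  have "x \<in> EL_level l ?k" "y \<in> EL_level l ?k"
    using mn EL_level_mono[OF le_SucI[OF max.cobounded1], of l m n]
      EL_level_mono[OF le_SucI[OF max.cobounded2], of l n m] by blast+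
  moreover have "complex_subfield (EL_level l ?k)"
    by (simp add: complex_subfield_alg_closure complex_subfield_gen_field)
  ultimately have "x / y \<in> EL_level l ?k" by (rule subfield_divide[rotated])
  thus ?thesis unfolding EL_def by blast
qed

text \<open>Integer coefficients lie in every generated field, so level 1 already contains all
  algebraic numbers.\<close>

lemma algebraic_in_EL:
  assumes "algebraic b"
  shows "b \<in> EL l"
proof -
  obtain p where p: "p \<noteq> 0" "\<And>i. coeff p i \<in> \<int>" "poly p b = 0"
    using assms by (auto elim: algebraicE)
  have "coeff p i \<in> gen_field S" for i S
    using p(2)[of i] by (auto elim!: Ints_cases simp: subfield_of_int[OF complex_subfield_gen_field])
  hence "b \<in> EL_level l 1" using p by (auto intro!: alg_closureI[of p])
  thus ?thesis unfolding EL_def by blast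
qed

text \<open>The quotient is a logarithm to the base \<open>exp l\<close>, since
  \<open>bpow l (L / l) = exp L\<close>.\<close>

lemma EL_log:
  assumes "exp L \<in> EL l" "l \<noteq> 0"
  shows "L / l \<in> EL l"
proof -
  obtain n where "exp L \<in> EL_level l n" using assms by (auto simp: EL_def)
  hence "L / l \<in> Logb l (EL_level l n)" using assms(2) by (simp add: Logb_def bpow_def)
  hence "L / l \<in> EL_level l (Suc n)"
    using subset_alg_closure[OF complex_subfield_gen_field] gen_base by force
  thus ?thesis unfolding EL_def by blast
qed

theorem theorem11p5:
  assumes "schanuel_conjecture"
  shows "(\<forall>b L. algebraic b \<and> b \<noteq> 0 \<and> b \<noteq> 1 \<and> L \<noteq> 0 \<and> exp L = b \<longrightarrow> L \<notin> EL_alg)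
       \<and> complex_of_real pi \<notin> EL_alg
       \<and> exp (1::complex) \<notin> EL_alg
       \<and> (\<forall>a\<in>EL_alg - {0, 1}. \<forall>L. exp L = a \<longrightarrow> L \<notin> EL_alg)"
proof -
  define l where "l = \<i> * complex_of_real pi"
  have l: "l \<noteq> 0" "exp l = -1" "EL_alg = EL l" by (auto simp: l_def EL_alg_def)
  have "-1 \<in> acl {}" by (intro subfield_uminus subfield_1 acl_subfield)
  hence notin: "l \<notin> EL l" using schanuel_notin_EL[OF assms l(1)] l(2) by simp
  have log: "L \<notin> EL l" if "exp L \<in> EL l" "L \<noteq> 0" for L
  proof
    assume "L \<in> EL l"
    hence "L / (L / l) \<in> EL l" by (rule EL_divide[OF _ EL_log[OF that(1) l(1)]])
    thus False using notin that(2) by simp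
  qed
  have one: "1 \<in> EL l" and i: "- \<i> \<in> EL l"
    by (auto intro: algebraic_in_EL)
  have "complex_of_real pi \<notin> EL l"
  proof
    assume "complex_of_real pi \<in> EL l"
    \<comment> \<open>Dividing by the algebraic number \<open>- \<i>\<close> turns \<open>pi\<close>
      into \<open>l\<close>.\<close>
    hence "complex_of_real pi / - \<i> \<in> EL l" using i by (rule EL_divide)
    thus False using notin by (simp add: l_def divide_complex_def mult.commute)
  qed
  moreover have "exp (1::complex) \<notin> EL l" using log[of 1] one by auto
  \<comment> \<open>The value \<open>L = 0\<close> is excluded by \<open>a \<noteq> 1\<close>, so
    \<open>log\<close> applies.\<close>
  moreover have "L \<notin> EL l" if "exp L = a" "a \<in> EL l" "a \<noteq> 1" for L a
    using log[of L] that by (cases "L = 0") auto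
  ultimately show ?thesis
    unfolding l(3) using algebraic_in_EL[of _ l] by blast
qed

end
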